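(* The class of groups is globally closed. That is, if a group $H$ is globally isomorphic to a semigroup $K$, then $K$ is isomorphic to a group (equivalently, $K$ is a group).
   Context: For a semigroup $S$ (written multiplicatively), $\mathcal P(S)$ denotes the semigroup of all non-empty subsets of $S$ under setwise multiplication $XY := \{xy : x \in X, y \in Y\}$. A semigroup $H$ is globally isomorphic to a semigroup $K$ if there is a semigroup isomorphism $\mathcal P(H) \to \mathcal P(K)$. A class $\mathscr C$ of semigroups is globally closed if, whenever a semigroup $H \in \mathscr C$ is globally isomorphic to a semigroup $K$, there exists a semigroup $K' \in \mathscr C$ that is isomorphic to $K$. *)

theory Defs
  imports "HOL-Algebra.Coset"
begin

(* A semigroup is represented by a record of type monoid of which only the fields carrier and mult
   matter; the field one is ignored. None of hom, iso, \<cong> and <#> refers to it either. *)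
locale alg_semigroup =
  fixes S (structure)
  assumes m_closed: "\<lbrakk>x \<in> carrier S; y \<in> carrier S\<rbrakk> \<Longrightarrow> x \<otimes> y \<in> carrier S"
    and m_assoc: "\<lbrakk>x \<in> carrier S; y \<in> carrier S; z \<in> carrier S\<rbrakk>
      \<Longrightarrow> (x \<otimes> y) \<otimes> z = x \<otimes> (y \<otimes> z)"

lemma (in monoid) is_alg_semigroup: "alg_semigroup G"
  by (simp add: alg_semigroup_def m_assoc)

definition power_semigroup :: "('a, 'm) monoid_scheme \<Rightarrow> 'a set monoid" where
  "power_semigroup S =
     \<lparr>carrier = {X. X \<subseteq> carrier S \<and> X \<noteq> {}},
      mult = (\<lambda>X Y. X <#>\<^bsub>S\<^esub> Y),
      one = {\<one>\<^bsub>S\<^esub>}\<rparr>"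

lemma power_semigroup_is_alg_semigroup:
  assumes "alg_semigroup S"
  shows "alg_semigroup (power_semigroup S)"
proof -
  interpret alg_semigroup S by fact
  show ?thesis
  proof
    fix X Y
    assume "X \<in> carrier (power_semigroup S)" "Y \<in> carrier (power_semigroup S)"
    then show "X \<otimes>\<^bsub>power_semigroup S\<^esub> Y \<in> carrier (power_semigroup S)"
      by (auto simp: power_semigroup_def set_mult_def intro!: m_closed)
  next
    fix X Y Z
    assume "X \<in> carrier (power_semigroup S)" "Y \<in> carrier (power_semigroup S)"
      "Z \<in> carrier (power_semigroup S)"
    then have "X \<subseteq> carrier S" "Y \<subseteq> carrier S" "Z \<subseteq> carrier S"
      by (auto simp: power_semigroup_def)
    then have "(x \<otimes>\<^bsub>S\<^esub> y) \<otimes>\<^bsub>S\<^esub> z = x \<otimes>\<^bsub>S\<^esub> (y \<otimes>\<^bsub>S\<^esub> z)"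
      if "x \<in> X" "y \<in> Y" "z \<in> Z" for x y z
      using that by (intro m_assoc) auto
    then show "X \<otimes>\<^bsub>power_semigroup S\<^esub> Y \<otimes>\<^bsub>power_semigroup S\<^esub> Z =
        X \<otimes>\<^bsub>power_semigroup S\<^esub> (Y \<otimes>\<^bsub>power_semigroup S\<^esub> Z)"
      by (simp add: power_semigroup_def set_mult_def)
  qed
qed

definition globally_isomorphic :: "('a, 'm) monoid_scheme \<Rightarrow> ('b, 'n) monoid_scheme \<Rightarrow> bool" where
  "globally_isomorphic H K \<longleftrightarrow> power_semigroup H \<cong> power_semigroup K"

(* A class of semigroups is a predicate defined for every carrier type. As HOL predicates are
   monomorphic arguments, the class is passed as its two instances C and D at the carrier types of
   H and of K, so that H and K need not have elements of the same type. The witness K' can be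
   sought at the type of K, since it is isomorphic to K. *)
definition globally_closed :: "('a monoid \<Rightarrow> bool) \<Rightarrow> ('b monoid \<Rightarrow> bool) \<Rightarrow> bool" where
  "globally_closed C D \<longleftrightarrow>
     (\<forall>(H :: 'a monoid) (K :: 'b monoid). C H \<longrightarrow> alg_semigroup K \<longrightarrow> globally_isomorphic H K
        \<longrightarrow> (\<exists>K'. D K' \<and> K' \<cong> K))"

end

theory Submission
  imports Defs
begin

text \<open>Let \<open>f\<close> be an isomorphism from the power semigroup of the group \<open>H\<close> to that of \<open>K\<close>.
The identity \<open>f {1}\<close> of the latter is a singleton \<open>{e}\<close>, so \<open>K\<close> is a monoid, and every element
of \<open>V = (\<Union>h. f {h})\<close> is invertible. Since \<open>f {h} V = V\<close> for all \<open>h\<close>, the preimage \<open>A\<close> of \<open>V\<close>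
satisfies \<open>h A = A\<close> for all \<open>h\<close>, so that \<open>A = H\<close>. But \<open>H\<close> is absorbing, hence so is \<open>V\<close>;
therefore \<open>x = x e\<close> lies in \<open>V\<close> for every \<open>x\<close> in \<open>K\<close>.\<close>

lemma carrier_power_semigroup_iff:
  "X \<in> carrier (power_semigroup S) \<longleftrightarrow> X \<subseteq> carrier S \<and> X \<noteq> {}"
  by (simp add: power_semigroup_def)

lemma mult_power_semigroup: "X \<otimes>\<^bsub>power_semigroup S\<^esub> Y = X <#>\<^bsub>S\<^esub> Y"
  by (simp add: power_semigroup_def)

text \<open>A single \<open>x\<close> in \<open>X\<close> already suffices, because every
  \<open>g\<close> is \<open>x\<close> times \<open>inv x\<close> times \<open>g\<close>. General
  \<open>X\<close> matter because the preimage of a singleton of \<open>K\<close> is not known to be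
  a singleton.\<close>

lemma (in group) set_mult_carrier_absorb:
  assumes "X \<subseteq> carrier G" "X \<noteq> {}"
  shows "X <#> carrier G = carrier G"
proof
  show "X <#> carrier G \<subseteq> carrier G"
    using assms by (auto simp: set_mult_def)
  obtain x where x: "x \<in> X" "x \<in> carrier G"
    using assms by blast
  show "carrier G \<subseteq> X <#> carrier G"
  proof
    fix g assume "g \<in> carrier G"
    then have "g = x \<otimes> (inv x \<otimes> g)" "inv x \<otimes> g \<in> carrier G"
      using x by (simp_all add: m_assoc [symmetric])
    then show "g \<in> X <#> carrier G"
      using x unfolding set_mult_def by blast
  qed
qed

text \<open>Left translations act transitively: the one by \<open>g\<close> times
  \<open>inv a\<close> moves a chosen \<open>a\<close> in \<open>A\<close> to any given
  \<open>g\<close>.\<close>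

lemma (in group) left_translation_invariant_eq_carrier:
  assumes "A \<subseteq> carrier G" "A \<noteq> {}"
    and inv: "\<And>h. h \<in> carrier G \<Longrightarrow> {h} <#> A \<subseteq> A"
  shows "A = carrier G"
proof
  obtain a where a: "a \<in> A" "a \<in> carrier G"
    using assms by blast
  show "carrier G \<subseteq> A"
  proof
    fix g assume g: "g \<in> carrier G"
    then have "(g \<otimes> inv a) \<otimes> a \<in> {g \<otimes> inv a} <#> A"
      using a unfolding set_mult_def by blast
    then have "(g \<otimes> inv a) \<otimes> a \<in> A"
      using inv [of "g \<otimes> inv a"] g a by blast
    then show "g \<in> A"
      using g a by (simp add: m_assoc)
  qed
qed (fact assms)

text \<open>The field \<open>one\<close> of \<open>K\<close> is arbitrary, so the identity found in
  the proof has to be written into the record.\<close>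

lemma group_if_globally_isomorphic:
  assumes "group H" "alg_semigroup K" "globally_isomorphic H K"
  shows "\<exists>e. group (K\<lparr>one := e\<rparr>)"
proof -
  interpret H: group H by fact
  interpret K: alg_semigroup K by fact
  obtain f where "f \<in> iso (power_semigroup H) (power_semigroup K)"
    using assms(3) by (auto simp: globally_isomorphic_def is_iso_def)
  then have hom: "f \<in> hom (power_semigroup H) (power_semigroup K)"
    and bij: "bij_betw f (carrier (power_semigroup H)) (carrier (power_semigroup K))"
    by (auto simp: iso_def)
  have f_carrier: "f X \<subseteq> carrier K" "f X \<noteq> {}" if "X \<subseteq> carrier H" "X \<noteq> {}" for X
    using hom_in_carrier [OF hom, of X] that by (simp_all add: carrier_power_semigroup_iff)
  have f_mult: "f (X <#>\<^bsub>H\<^esub> Y) = f X <#>\<^bsub>K\<^esub> f Y"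
    if "X \<subseteq> carrier H" "X \<noteq> {}" "Y \<subseteq> carrier H" "Y \<noteq> {}" for X Y
    using hom_mult [OF hom, of X Y] that
    by (simp add: carrier_power_semigroup_iff mult_power_semigroup)
  have f_inj: "X = Y"
    if "X \<subseteq> carrier H" "X \<noteq> {}" "Y \<subseteq> carrier H" "Y \<noteq> {}" "f X = f Y" for X Y
    using bij that by (auto simp: bij_betw_def inj_on_def carrier_power_semigroup_iff)
  have f_surj: "\<exists>X. X \<subseteq> carrier H \<and> X \<noteq> {} \<and> f X = Y" if "Y \<subseteq> carrier K" "Y \<noteq> {}" for Y
  proof -
    have "Y \<in> f ` carrier (power_semigroup H)"
      using bij that by (simp add: bij_betw_def carrier_power_semigroup_iff)
    then show ?thesis
      unfolding image_iff Bex_def carrier_power_semigroup_iff by metis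
  qed
  have f_prod: "f {g} <#>\<^bsub>K\<^esub> f {h} = f {g \<otimes>\<^bsub>H\<^esub> h}" if "g \<in> carrier H" "h \<in> carrier H" for g h
    using f_mult [of "{g}" "{h}"] that by (simp add: set_mult_def)

  define E where "E = f {\<one>\<^bsub>H\<^esub>}"
  have E_neutral: "E <#>\<^bsub>K\<^esub> {x} = {x}" "{x} <#>\<^bsub>K\<^esub> E = {x}" if x: "x \<in> carrier K" for x
  proof -
    obtain X where X: "X \<subseteq> carrier H" "X \<noteq> {}" "f X = {x}"
      using f_surj [of "{x}"] x by blast
    have "{\<one>\<^bsub>H\<^esub>} <#>\<^bsub>H\<^esub> X = X" "X <#>\<^bsub>H\<^esub> {\<one>\<^bsub>H\<^esub>} = X"
      using X(1) by (force simp: set_mult_def)+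
    then show "E <#>\<^bsub>K\<^esub> {x} = {x}" "{x} <#>\<^bsub>K\<^esub> E = {x}"
      using f_mult [of "{\<one>\<^bsub>H\<^esub>}" X] f_mult [of X "{\<one>\<^bsub>H\<^esub>}"] X by (simp_all add: E_def)
  qed
  have E_carrier: "E \<subseteq> carrier K" "E \<noteq> {}"
    using f_carrier [of "{\<one>\<^bsub>H\<^esub>}"] by (simp_all add: E_def)
  then obtain e where e: "e \<in> E" "e \<in> carrier K"
    by blast
  \<comment> \<open>The product of \<open>E\<close> with \<open>{x}\<close> is a singleton, so each
    single element of \<open>E\<close> fixes \<open>x\<close>.\<close>
  have neutral: "d \<otimes>\<^bsub>K\<^esub> x = x" "x \<otimes>\<^bsub>K\<^esub> d = x" if "x \<in> carrier K" "d \<in> E" for d x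
    using E_neutral [OF that(1)] that(2) by (auto simp: set_mult_def)
  \<comment> \<open>Both \<open>d\<close> and \<open>e\<close> are two-sided identities, hence both
    equal their product.\<close>
  have E_eq: "d = e" if "d \<in> E" for d
    using neutral(1) [of d e] neutral(1) [of e d] neutral(2) [of d e] e E_carrier(1) that by auto

  \<comment> \<open>The sets \<open>f {h}\<close> may a priori have many elements, so all of these
    are collected.\<close>
  define V where "V = (\<Union>h\<in>carrier H. f {h})"
  have e_V: "e \<in> V"
    using e by (auto simp: V_def E_def)
  have "V \<subseteq> carrier K"
    using f_carrier(1) by (auto simp: V_def)
  then obtain A where A: "A \<subseteq> carrier H" "A \<noteq> {}" "f A = V"
    using f_surj [of V] e_V by blast
  \<comment> \<open>Multiplication by \<open>f {h}\<close> only permutes the sets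
    \<open>f {g}\<close> whose union is \<open>V\<close>, as left translation by \<open>h\<close>
    permutes \<open>H\<close>.\<close>
  have V_invariant: "f {h} <#>\<^bsub>K\<^esub> V = V" if h: "h \<in> carrier H" for h
  proof -
    have "f {h} <#>\<^bsub>K\<^esub> V = (\<Union>g\<in>carrier H. f {h} <#>\<^bsub>K\<^esub> f {g})"
      by (auto simp: V_def set_mult_def)
    also have "\<dots> = (\<Union>g\<in>(\<lambda>g. h \<otimes>\<^bsub>H\<^esub> g) ` carrier H. f {g})"
      using h by (simp add: f_prod)
    also have "(\<lambda>g. h \<otimes>\<^bsub>H\<^esub> g) ` carrier H = carrier H"
      using h by (rule H.surj_const_mult)
    finally show ?thesis
      by (simp add: V_def)
  qed
  \<comment> \<open>The invariance of \<open>V\<close> is pulled back to \<open>A\<close> by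
    injectivity of \<open>f\<close>.\<close>
  have "{h} <#>\<^bsub>H\<^esub> A = A" if h: "h \<in> carrier H" for h
  proof (rule f_inj)
    show "{h} <#>\<^bsub>H\<^esub> A \<subseteq> carrier H" "{h} <#>\<^bsub>H\<^esub> A \<noteq> {}"
      using h A by (auto simp: set_mult_def)
    show "f ({h} <#>\<^bsub>H\<^esub> A) = f A"
      using f_mult [of "{h}" A] h A V_invariant [OF h] by simp
  qed (use A in auto)
  then have "A = carrier H"
    using A H.left_translation_invariant_eq_carrier by simp
  then have f_H: "f (carrier H) = V"
    using A by simp
  have in_V: "x \<in> V" if x: "x \<in> carrier K" for x
  proof -
    obtain X where X: "X \<subseteq> carrier H" "X \<noteq> {}" "f X = {x}"
      using f_surj [of "{x}"] x by blast
    \<comment> \<open>This is the image under \<open>f\<close> of the equation saying that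
      \<open>X\<close> times the carrier of \<open>H\<close> is that carrier.\<close>
    have "{x} <#>\<^bsub>K\<^esub> V = V"
      using f_mult [of X "carrier H"] X f_H H.set_mult_carrier_absorb [of X] by auto
    moreover have "x \<otimes>\<^bsub>K\<^esub> e \<in> {x} <#>\<^bsub>K\<^esub> V"
      using e_V by (auto simp: set_mult_def)
    ultimately show ?thesis
      using neutral(2) [OF x e(1)] by simp
  qed
  \<comment> \<open>If \<open>x\<close> lies in \<open>f {h}\<close>, any \<open>y\<close> in the
    image of the singleton of the inverse of \<open>h\<close> works: the product of \<open>y\<close>
    and \<open>x\<close> lies in \<open>E\<close>, whose only element is \<open>e\<close>.\<close>
  have left_inverse: "\<exists>y\<in>carrier K. y \<otimes>\<^bsub>K\<^esub> x = e" if x: "x \<in> carrier K" for x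
  proof -
    obtain h where h: "h \<in> carrier H" "x \<in> f {h}"
      using in_V [OF x] by (auto simp: V_def)
    obtain y where y: "y \<in> f {inv\<^bsub>H\<^esub> h}" "y \<in> carrier K"
      using f_carrier [of "{inv\<^bsub>H\<^esub> h}"] h by auto
    have "y \<otimes>\<^bsub>K\<^esub> x \<in> E"
      using f_prod [of "inv\<^bsub>H\<^esub> h" h] h y by (auto simp: E_def set_mult_def)
    then show ?thesis
      using y E_eq by blast
  qed
  have "group (K\<lparr>one := e\<rparr>)"
    by (rule groupI) (use e neutral left_inverse in \<open>auto simp: K.m_closed K.m_assoc\<close>)
  then show ?thesis ..
qed

lemma iso_one_update: "K\<lparr>one := e\<rparr> \<cong> K"
proof -
  have "(\<lambda>x. x) \<in> iso (K\<lparr>one := e\<rparr>) K"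
    by (simp add: iso_def hom_def bij_betw_def)
  then show ?thesis
    by (rule is_isoI)
qed

theorem corollary2p4:
  shows "globally_closed (group :: 'a monoid \<Rightarrow> bool) (group :: 'b monoid \<Rightarrow> bool)
    \<and> (\<forall>(H :: 'a monoid) (K :: 'b monoid).
          group H \<longrightarrow> alg_semigroup K \<longrightarrow> globally_isomorphic H K
          \<longrightarrow> (\<exists>e. group (K\<lparr>one := e\<rparr>)))"
proof (unfold globally_closed_def, intro conjI allI impI)
  fix H :: "'a monoid" and K :: "'b monoid"
  assume "group H" "alg_semigroup K" "globally_isomorphic H K"
  then obtain e where "group (K\<lparr>one := e\<rparr>)"
    using group_if_globally_isomorphic by metis
  then show "\<exists>K' :: 'b monoid. group K' \<and> K' \<cong> K"
    by (intro exI [of _ "K\<lparr>one := e\<rparr>"] conjI iso_one_update)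
qed (rule group_if_globally_isomorphic)

end
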